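(* Let $M\in\mathbb N$ and let $\mathcal E=(E_k)_{k\ge1}$ be a uniformly bounded sequence of nonempty closed sets $E_k\subset\mathbb R$ that is $M$-periodic, i.e. $E_{k+M}=E_k$ for all $k\in\mathbb N$. Suppose that for every $r\in\mathbb N$ there exist $n\in\mathbb N$ and a polynomial $P_n(x)=1+\sum_{k=1}^n\varepsilon_kx^k$ with $\varepsilon_k\in E_k$ for all $k=1,\dots,n$ that has at least $r$ distinct roots in $[0,1]$. Then $$\sum_{k=1}^M\min E_k<0\quad\text{and}\quad\sum_{k=1}^M\max E_k>0 .$$
   Context: Uniformly bounded means that there is $A\in(0,+\infty)$ such that $E_k\subset[-A,A]$ for all $k\in\mathbb N$. *)

theory Defs
  imports "HOL-Analysis.Analysis" "HOL-Computational_Algebra.Polynomial"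
begin

end

theory Submission
  imports Defs "HOL-Complex_Analysis.Complex_Analysis"
begin

text \<open>
Suppose that the sum of the minima over a period is nonnegative.  Subtracting its mean from the
minima gives a periodic lower bound \<open>c\<close> for the coefficients with period sum zero.  It has to
be shown that the polynomials \<open>P\<close> with coefficients \<open>e k \<ge> c k\<close>, bounded, and with fixed
nonzero constant term \<open>s\<close> have a bounded number of roots in \<open>[0, 1]\<close>.  For the maxima the
same statement is applied to \<open>- P\<close>, with \<open>s = - 1\<close>.

Put \<open>x = exp (- t)\<close>.  If the numbers of roots were unbounded, there would be a point \<open>t0 \<ge> 0\<close> and
such polynomials with more and more zeros closer and closer to \<open>t0\<close>, whose coefficients
may be assumed to converge individually.  Away from \<open>t0 = 0\<close> the limiting power series then has a
zero of infinite order.  The difficulty is \<open>t0 = 0\<close>, that is \<open>x = 1\<close>, the edge of convergence.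
There the period sum zero enters: the series of \<open>c\<close> continues analytically across \<open>x = 1\<close>
to a function \<open>\<rho>\<close> of \<open>t\<close>, and the excess \<open>d k = e k - c k\<close> is nonnegative for \<open>k \<ge> 1\<close>.
All points \<open>t0\<close> are treated by the same argument.

Cutting the series of \<open>c\<close> at the degree \<open>n\<close> leaves an error \<open>exp (- n t)\<close> times another tail,
which is not small at distances of order \<open>1 / n\<close> from 0.  It is removed by applying
\<open>(1 + (d/dt) / n) ^ q\<close>: this costs at most \<open>q\<close> zeros by Rolle's theorem, multiplies \<open>d k\<close> by
\<open>(1 - k / n) ^ q\<close>, so that signs are preserved and each fixed coefficient is asymptotically unchanged,
and makes the derivatives of the error of order below \<open>q\<close> negligible
(lemma \<open>weighted_expsum_limit\<close>).  Further uses of Rolle's theorem yield zeros of the \<open>p\<close>-th and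
\<open>(p + 1)\<close>-th derivatives near \<open>t0\<close>.  In the limit, positivity gives for all \<open>p\<close>
(lemma \<open>limit_moments\<close>) that the sum over \<open>k\<close> of \<open>d k * (- k) ^ p * exp (- k t0)\<close> equals
minus the \<open>p\<close>-th derivative of \<open>\<rho>\<close> at \<open>t0\<close>.

Since \<open>\<rho>\<close> is analytic at \<open>t0\<close>, these moments determine the excess series: it equals \<open>- \<rho>\<close>
on an interval to the right of \<open>t0\<close> (lemma \<open>sums_from_moments\<close>).  There the full limiting power
series vanishes, hence all its coefficients vanish, contradicting its constant term \<open>s\<close>
(lemma \<open>no_clustering_sequence\<close>).
\<close>

section \<open>Zeros of exponential sums\<close>

definition expsum :: "(nat \<Rightarrow> real) \<Rightarrow> nat \<Rightarrow> real \<Rightarrow> real" where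
  "expsum a n t = (\<Sum>k\<le>n. a k * exp (- (real k * t)))"

text \<open>
These are the coefficients produced on \<open>exp (- k t)\<close> by the operator
\<open>(d/dt) ^ p\<close> composed with \<open>(n + d/dt) ^ q\<close>.  For \<open>k \<le> n\<close> their sign depends only
on \<open>p\<close>, and they are damped near the end \<open>k = n\<close>.
\<close>

definition weight :: "nat \<Rightarrow> nat \<Rightarrow> nat \<Rightarrow> nat \<Rightarrow> real" where
  "weight n p q k = (- real k) ^ p * (real n - real k) ^ q"

lemma expsum_has_derivative:
  "(expsum a n has_real_derivative expsum (\<lambda>k. - real k * a k) n t) (at t)"
  unfolding expsum_def[abs_def]
  by (auto intro!: derivative_eq_intros sum.cong simp: mult_ac)

lemma expsum_scale: "expsum (\<lambda>k. x * a k) n t = x * expsum a n t"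
  by (simp add: expsum_def sum_distrib_left mult_ac)

lemma expsum_add: "expsum (\<lambda>k. a k + b k) n t = expsum a n t + expsum b n t"
  by (simp add: expsum_def sum.distrib algebra_simps)

text \<open>
Rolle's theorem between neighbouring zeros.  The bound by the extreme zeros keeps the
induction going and later provides a zero of the derivative strictly to the left of a
zero of the function.
\<close>

lemma zeros_of_derivative:
  fixes f f' :: "real \<Rightarrow> real"
  assumes der: "\<And>t. (f has_real_derivative f' t) (at t)"
    and "finite Z" "\<And>z. z \<in> Z \<Longrightarrow> f z = 0" "Z \<noteq> {}"
  shows "\<exists>Z'. finite Z' \<and> Suc (card Z') = card Z \<and> Z' \<subseteq> {Min Z<..<Max Z} \<and> (\<forall>z\<in>Z'. f' z = 0)"
  using assms(2-4)
proof (induction Z rule: finite_linorder_max_induct)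
  case empty
  then show ?case by simp
next
  case (insert b A)
  show ?case
  proof (cases "A = {}")
    case True
    then show ?thesis by (intro exI[of _ "{}"]) auto
  next
    case False
    from insert.IH[OF insert.prems(1) False] obtain Z' where
      Z': "finite Z'" "Suc (card Z') = card A" "Z' \<subseteq> {Min A<..<Max A}" "\<forall>z\<in>Z'. f' z = 0"
      by auto
    have lt: "Max A < b" using insert.hyps False by simp
    have "Max A \<in> A" using insert.hyps False by simp
    then have z: "f (Max A) = 0" "f b = 0" using insert.prems by auto
    have cont: "continuous_on {Max A..b} f"
      using der by (meson DERIV_isCont continuous_at_imp_continuous_on)
    obtain w where w: "Max A < w" "w < b" "f' w = 0"
    proof -
      have "\<exists>z. Max A < z \<and> z < b \<and> f' z = 0"
      proof -
        obtain l z where lz: "Max A < z" "z < b" "DERIV f z :> l" "f b - f (Max A) = (b - Max A) * l"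
          using MVT[OF lt cont] der real_differentiable_def by blast
        then have "l = 0" using z lt by simp
        moreover have "l = f' z" using lz(3) der DERIV_unique by blast
        ultimately show ?thesis using lz by auto
      qed
      then show ?thesis using that by blast
    qed
    have "w \<notin> Z'" using Z'(3) w by auto
    have mins: "Min (insert b A) = Min A" 
      using insert.hyps False Min_in[of A] by (auto simp: min_def dest: leD)
    have maxs: "Max (insert b A) = b" 
      using insert.hyps False lt by (simp add: max_def) (use lt in linarith)
    have "Min A \<le> Max A" using insert.hyps False by simp
    have bA: "b \<notin> A" using insert.hyps by auto
    show ?thesis
      apply (intro exI[of _ "insert w Z'"])
      unfolding mins maxs
      using Z' w \<open>w \<notin> Z'\<close> lt \<open>Min A \<le> Max A\<close> bA insert.hyps(1) by fastforce
  qed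
qed

text \<open>
Multiplying by \<open>exp (x t)\<close> before differentiating turns Rolle's theorem for \<open>d/dt\<close> into
one for \<open>x + d/dt\<close>, at the same price of a single zero.
\<close>

lemma expsum_zeros_step:
  assumes "finite Z" "Suc m \<le> card Z" "Z \<subseteq> {u..v}" "\<And>z. z \<in> Z \<Longrightarrow> expsum a n z = 0"
  shows "\<exists>Z'. finite Z' \<and> m \<le> card Z' \<and> Z' \<subseteq> {u..v} \<and> (\<forall>z\<in>Z'. expsum (\<lambda>k. (x - real k) * a k) n z = 0)"
proof -
  have "Z \<noteq> {}" using assms by auto
  have eq: "expsum (\<lambda>k. (x - real k) * a k) n t = x * expsum a n t + expsum (\<lambda>k. - real k * a k) n t" for t
    by (simp add: expsum_def sum_distrib_left flip: sum.distrib) (simp add: algebra_simps)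
  have der: "((\<lambda>t. exp (x * t) * expsum a n t) has_real_derivative
        exp (x * t) * expsum (\<lambda>k. (x - real k) * a k) n t) (at t)" for t
    unfolding eq
    by (auto intro!: derivative_eq_intros expsum_has_derivative simp: algebra_simps)
  obtain Z' where Z': "finite Z'" "Suc (card Z') = card Z" "Z' \<subseteq> {Min Z<..<Max Z}"
    "\<forall>z\<in>Z'. exp (x * z) * expsum (\<lambda>k. (x - real k) * a k) n z = 0"
    using zeros_of_derivative[OF der assms(1) _ \<open>Z \<noteq> {}\<close>] assms(4) by auto
  have "Min Z \<in> Z" "Max Z \<in> Z" using assms \<open>Z \<noteq> {}\<close> by auto
  then have "u \<le> Min Z" "Max Z \<le> v" using assms(3) by auto
  with Z' assms(2) show ?thesis by (intro exI[of _ Z']) auto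
qed

lemma expsum_zeros_iterate:
  assumes "finite Z" "m + p + q \<le> card Z" "Z \<subseteq> {u..v}" "\<And>z. z \<in> Z \<Longrightarrow> expsum a n z = 0"
  shows "\<exists>Z'. finite Z' \<and> m \<le> card Z' \<and> Z' \<subseteq> {u..v} \<and>
     (\<forall>z\<in>Z'. expsum (\<lambda>k. weight n p q k * a k) n z = 0)"
  using assms(2)
proof (induction p arbitrary: m)
  case 0
  then show ?case
  proof (induction q arbitrary: m)
    case 0
    then show ?case using assms by (intro exI[of _ Z]) (auto simp: weight_def)
  next
    case (Suc q)
    then have "Suc m + 0 + q \<le> card Z" by simp
    from Suc.IH[OF this] obtain Y where Y: "finite Y" "Suc m \<le> card Y" "Y \<subseteq> {u..v}"
      "\<And>z. z \<in> Y \<Longrightarrow> expsum (\<lambda>k. weight n 0 q k * a k) n z = 0"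
      by blast
    from expsum_zeros_step[OF this, of "real n"] show ?case
      by (simp add: weight_def mult_ac)
  qed
next
  case (Suc p)
  then have "Suc m + p + q \<le> card Z" by simp
  from Suc.IH[OF this] obtain Y where Y: "finite Y" "Suc m \<le> card Y" "Y \<subseteq> {u..v}"
      "\<And>z. z \<in> Y \<Longrightarrow> expsum (\<lambda>k. weight n p q k * a k) n z = 0"
    by blast
  from expsum_zeros_step[OF this, of 0] show ?case
    by (simp add: weight_def mult_ac)
qed

text \<open>
The two zeros serve different purposes: the later one \<open>t\<close> determines the value of the
\<open>p\<close>-th moment, and the earlier one \<open>t'\<close> bounds the next moment, which dominates the
tail of the \<open>p\<close>-th moment at \<open>t\<close> because \<open>exp (- k t) \<le> exp (- k t')\<close>.
\<close>

lemma expsum_zero_pair: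
  assumes "finite Z" "2 + p + q \<le> card Z" "Z \<subseteq> {u..v}" "\<And>z. z \<in> Z \<Longrightarrow> expsum a n z = 0"
  shows "\<exists>t' t. u \<le> t' \<and> t' < t \<and> t \<le> v \<and> expsum (\<lambda>k. weight n p q k * a k) n t = 0 \<and>
     expsum (\<lambda>k. weight n (Suc p) q k * a k) n t' = 0"
proof -
  let ?b = "\<lambda>k. weight n p q k * a k"
  obtain Y where Y: "finite Y" "2 \<le> card Y" "Y \<subseteq> {u..v}" "\<And>z. z \<in> Y \<Longrightarrow> expsum ?b n z = 0"
    using expsum_zeros_iterate[OF assms] by auto
  have "Y \<noteq> {}" using Y(2) by auto
  obtain X where X: "Suc (card X) = card Y" "X \<subseteq> {Min Y<..<Max Y}"
    "\<forall>z\<in>X. expsum (\<lambda>k. - real k * ?b k) n z = 0"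
    using zeros_of_derivative[OF expsum_has_derivative Y(1) Y(4) \<open>Y \<noteq> {}\<close>] by auto
  have "card X \<noteq> 0" using X(1) Y(2) by simp
  then obtain z where z: "z \<in> X" by fastforce
  have mm: "Min Y \<in> Y" "Max Y \<in> Y" using Y \<open>Y \<noteq> {}\<close> by auto
  moreover have "expsum (\<lambda>k. weight n (Suc p) q k * a k) n z = 0"
    using X(3) z by (simp add: weight_def mult_ac)
  moreover have "u \<le> Min Y" "Max Y \<le> v" using mm Y(3) by auto
  moreover have "Min Y < z" "z < Max Y" using X(2) z by auto
  ultimately show ?thesis using Y(4)
    by (intro exI[of _ z] exI[of _ "Max Y"]) auto
qed

text \<open>
The operator \<open>(x + d/dt) ^ m\<close> applied to the \<open>i\<close>-th member of a sequence of successive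
derivatives; the recursion avoids binomial expansions.
\<close>

primrec shifted :: "real \<Rightarrow> nat \<Rightarrow> (nat \<Rightarrow> real \<Rightarrow> real) \<Rightarrow> nat \<Rightarrow> real \<Rightarrow> real" where
  "shifted x 0 f i t = f i t"
| "shifted x (Suc m) f i t = x * shifted x m f i t + shifted x m f (Suc i) t"

definition deriv_family :: "(nat \<Rightarrow> real \<Rightarrow> real) \<Rightarrow> bool" where
  "deriv_family f \<longleftrightarrow> (\<forall>i t. (f i has_real_derivative f (Suc i) t) (at t))"

lemma shifted_has_derivative:
  assumes "deriv_family f"
  shows "(shifted x m f i has_real_derivative shifted x m f (Suc i) t) (at t)"
proof (induction m arbitrary: i)
  case 0
  then show ?case using assms by (simp add: deriv_family_def)
next
  case (Suc m)
  show ?case by (auto intro!: derivative_eq_intros Suc)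
qed

text \<open>
Each factor \<open>1 + (d/dt) / x\<close> tends to the identity as \<open>x\<close> tends to infinity.
\<close>

lemma shifted_limit:
  assumes f: "deriv_family f" and x: "filterlim x at_infinity F" and t: "(t \<longlongrightarrow> t0) F"
  shows "((\<lambda>j. shifted (x j) m f i (t j) / x j ^ m) \<longlongrightarrow> f i t0) F"
proof (induction m arbitrary: i)
  case 0
  have "isCont (f i) t0" using f DERIV_isCont unfolding deriv_family_def by blast
  then show ?case using t by (simp add: isCont_tendsto_compose)
next
  case (Suc m)
  have "((\<lambda>j. shifted (x j) m f i (t j) / x j ^ m +
     shifted (x j) m f (Suc i) (t j) / x j ^ m * inverse (x j)) \<longlongrightarrow> f i t0 + f (Suc i) t0 * 0) F"
    using tendsto_inverse_0 x
    by (intro tendsto_intros Suc) (blast intro: filterlim_compose)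
  moreover have "eventually (\<lambda>j. x j \<noteq> 0) F"
    using x by (rule filterlim_at_infinity_imp_eventually_ne)
  then have "eventually (\<lambda>j. shifted (x j) m f i (t j) / x j ^ m +
     shifted (x j) m f (Suc i) (t j) / x j ^ m * inverse (x j) = shifted (x j) (Suc m) f i (t j) / x j ^ Suc m) F"
    by eventually_elim (simp add: field_simps)
  ultimately show ?case using tendsto_cong by (fastforce dest: tendsto_cong)
qed

text \<open>
On the part \<open>exp (- n t) * g\<close> the two operators exchange their roles: \<open>n + d/dt\<close> only
differentiates \<open>g\<close>, while \<open>d/dt\<close> acts as \<open>- n + d/dt\<close>.  Hence that part grows
like \<open>n ^ p\<close>, against \<open>n ^ q\<close> for the other one.
\<close>

lemma weighted_expsum_closed_form:
  assumes f: "deriv_family f" and g: "deriv_family g"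
    and eq: "\<And>t. expsum c n t = f 0 t - exp (- (real n * t)) * g 0 t"
  shows "expsum (\<lambda>k. weight n p q k * c k) n t =
     shifted (real n) q f p t - exp (- (real n * t)) * shifted (- real n) p g q t"
proof (induction q arbitrary: p t)
  case 0
  show ?case
  proof (induction p arbitrary: t)
    case 0
    then show ?case using eq by (simp add: weight_def)
  next
    case (Suc p)
    have "(expsum (\<lambda>k. weight n p 0 k * c k) n has_real_derivative
        expsum (\<lambda>k. - real k * (weight n p 0 k * c k)) n t) (at t)"
      by (rule expsum_has_derivative)
    moreover have "((\<lambda>t. shifted (real n) 0 f p t - exp (- (real n * t)) * shifted (- real n) p g 0 t) 
       has_real_derivative shifted (real n) 0 f (Suc p) t - exp (- (real n * t)) * shifted (- real n) (Suc p) g 0 t) (at t)"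
      using f g by (auto intro!: derivative_eq_intros shifted_has_derivative simp: algebra_simps deriv_family_def)
    ultimately have "expsum (\<lambda>k. - real k * (weight n p 0 k * c k)) n t =
      shifted (real n) 0 f (Suc p) t - exp (- (real n * t)) * shifted (- real n) (Suc p) g 0 t"
      unfolding Suc.IH[abs_def] by (simp only: DERIV_unique)
    then show ?case by (simp add: weight_def mult_ac)
  qed
next
  case (Suc q)
  have "expsum (\<lambda>k. weight n p (Suc q) k * c k) n t = 
    real n * expsum (\<lambda>k. weight n p q k * c k) n t + expsum (\<lambda>k. weight n (Suc p) q k * c k) n t"
    by (simp add: weight_def algebra_simps flip: expsum_add expsum_scale)
  also have "\<dots> = shifted (real n) (Suc q) f p t - exp (- (real n * t)) * shifted (- real n) p g (Suc q) t"
    unfolding Suc.IH by (simp add: algebra_simps)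
  finally show ?case .
qed

section \<open>Periodic power series with mean zero\<close>

text \<open>
For a sequence \<open>c\<close> whose blocks of length \<open>M\<close> sum to zero, this rational function is
the sum of \<open>c (n + i) * z ^ i\<close> over \<open>i \<ge> 1\<close>: the factor \<open>1 - z\<close> common to the
period polynomial and to \<open>1 - z ^ M\<close> has been cancelled by summation by parts, so the
point \<open>z = 1\<close> is regular.
\<close>

definition tail_fun :: "(nat \<Rightarrow> real) \<Rightarrow> nat \<Rightarrow> nat \<Rightarrow> complex \<Rightarrow> complex" where
  "tail_fun c M n z = (\<Sum>i<M. of_real (\<Sum>l=1..i. c (n + l)) * z ^ i) / (\<Sum>i<M. z ^ i)"

definition tail_deriv :: "(nat \<Rightarrow> real) \<Rightarrow> nat \<Rightarrow> nat \<Rightarrow> nat \<Rightarrow> real \<Rightarrow> real" where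
  "tail_deriv c M n p t = Re ((deriv ^^ p) (\<lambda>z. tail_fun c M n (exp (- z))) (of_real t))"

definition zero_mean :: "(nat \<Rightarrow> real) \<Rightarrow> nat \<Rightarrow> bool" where
  "zero_mean c M \<longleftrightarrow> M \<ge> 1 \<and> (\<forall>k\<ge>1. c (k + M) = c k) \<and> (\<forall>n. (\<Sum>i=1..M. c (n + i)) = 0)"

lemma tail_fun_step:
  assumes "zero_mean c M" "(\<Sum>i<M. z ^ i) \<noteq> 0"
  shows "tail_fun c M n z = z * (of_real (c (Suc n)) + tail_fun c M (Suc n) z)"
proof -
  let ?b = "\<lambda>n i. complex_of_real (\<Sum>l=1..i. c (n + l))"
  have b: "?b n (Suc i) = of_real (c (Suc n)) + ?b (Suc n) i" for i
    by (induction i) (auto simp: algebra_simps)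
  have M: "?b n M = 0" using assms(1) by (simp add: zero_mean_def flip: of_real_sum)
  have "z * (of_real (c (Suc n)) * (\<Sum>i<M. z ^ i) + (\<Sum>i<M. ?b (Suc n) i * z ^ i))
    = (\<Sum>i<M. ?b n (Suc i) * z ^ Suc i)"
    unfolding b by (simp add: sum_distrib_left algebra_simps sum.distrib)
  also have "\<dots> = (\<Sum>i<Suc M. ?b n i * z ^ i)"
    by (subst sum.lessThan_Suc_shift) simp
  also have "\<dots> = (\<Sum>i<M. ?b n i * z ^ i)" using M by simp
  finally have "(\<Sum>i<M. ?b n i * z ^ i) = 
     z * (of_real (c (Suc n)) * (\<Sum>i<M. z ^ i) + (\<Sum>i<M. ?b (Suc n) i * z ^ i))" ..
  then show ?thesis using assms(2) unfolding tail_fun_def by (simp add: field_simps)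
qed

lemma geometric_sum_pos:
  assumes "M \<ge> (1::nat)" "x > (0::real)"
  shows "(\<Sum>i<M. x ^ i) > 0"
  using assms by (intro sum_pos) (auto simp: lessThan_empty_iff)

lemma geometric_sum_of_real_nonzero:
  assumes "M \<ge> (1::nat)" "x > (0::real)"
  shows "(\<Sum>i<M. complex_of_real x ^ i) \<noteq> 0"
  using geometric_sum_pos[OF assms] by (simp flip: of_real_power of_real_sum)

text \<open>
All zeros of \<open>1 + w + \<dots> + w ^ (M - 1)\<close> lie off the positive real axis, so in the variable
\<open>z\<close> with \<open>w = exp (- z)\<close> the tails are holomorphic near every real point.
\<close>

lemma tail_domain:
  fixes M :: nat
  assumes "M \<ge> 1"
  defines "S \<equiv> {z. (\<Sum>i<M. exp (- z) ^ i) \<noteq> (0::complex)}"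
  shows "open S" "complex_of_real t \<in> S" "(\<lambda>z. tail_fun c M n (exp (- z))) holomorphic_on S"
proof -
  show "open S" unfolding S_def
    by (intro open_Collect_neq continuous_intros)
  show "complex_of_real t \<in> S"
    using geometric_sum_of_real_nonzero[OF assms(1), of "exp (- t)"]
    by (simp add: S_def exp_of_real flip: of_real_minus)
  show "(\<lambda>z. tail_fun c M n (exp (- z))) holomorphic_on S"
    unfolding tail_fun_def S_def by (auto intro!: holomorphic_intros)
qed

lemma deriv_family_tail_deriv:
  assumes "M \<ge> 1"
  shows "deriv_family (tail_deriv c M n)"
  unfolding deriv_family_def
proof (intro allI)
  fix p t
  note D = tail_domain[OF assms]
  let ?h = "\<lambda>z. tail_fun c M n (exp (- z))"
  have "((deriv ^^ p) ?h has_field_derivative (deriv ^^ Suc p) ?h (of_real t)) (at (of_real t))"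
    by (rule has_field_derivative_higher_deriv[OF D(3) D(1) D(2)])
  then have "((\<lambda>t. (deriv ^^ p) ?h (of_real t)) has_vector_derivative (deriv ^^ Suc p) ?h (of_real t)) (at t)"
    by (rule has_vector_derivative_real_field)
  then have "((\<lambda>t. Re ((deriv ^^ p) ?h (of_real t))) has_vector_derivative Re ((deriv ^^ Suc p) ?h (of_real t))) (at t)"
    using bounded_linear.has_vector_derivative[OF bounded_linear_Re] by (fastforce simp: o_def)
  then show "(tail_deriv c M n p has_real_derivative tail_deriv c M n (Suc p) t) (at t)"
    unfolding tail_deriv_def[abs_def] has_real_derivative_iff_has_vector_derivative by simp
qed

lemma tail_deriv_taylor:
  assumes "M \<ge> 1"
  shows "\<exists>r>0. \<forall>y. \<bar>y\<bar> < r \<longrightarrow>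
    (\<lambda>p. tail_deriv c M n p t / fact p * y ^ p) sums tail_deriv c M n 0 (t + y)"
proof -
  note D = tail_domain[OF assms]
  let ?h = "\<lambda>z. tail_fun c M n (exp (- z))"
  obtain r where r: "r > 0" "ball (complex_of_real t) r \<subseteq> {z. (\<Sum>i<M. exp (- z) ^ i) \<noteq> (0::complex)}"
    using D(1) D(2) open_contains_ball by blast
  have "(\<lambda>p. tail_deriv c M n p t / fact p * y ^ p) sums tail_deriv c M n 0 (t + y)" if "\<bar>y\<bar> < r" for y
  proof -
    have "(\<lambda>p. (deriv ^^ p) ?h (of_real t) / fact p * (of_real (t + y) - of_real t) ^ p) sums ?h (of_real (t + y))"
      using that by (intro holomorphic_power_series holomorphic_on_subset[OF D(3)])
        (use r(2) in \<open>auto simp: dist_norm\<close>)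
    then have "(\<lambda>p. Re ((deriv ^^ p) ?h (of_real t) / fact p * (of_real (t + y) - of_real t) ^ p)) sums Re (?h (of_real (t + y)))"
      by (rule sums_Re)
    moreover have "Re ((deriv ^^ p) ?h (of_real t) / fact p * (of_real (t + y) - of_real t) ^ p) = 
       tail_deriv c M n p t / fact p * y ^ p" for p
    proof -
      have "(of_real (t + y) - of_real t :: complex) ^ p = of_real (y ^ p)" by simp
      moreover have "(fact p :: complex) = of_real (fact p)" by simp
      ultimately show ?thesis unfolding tail_deriv_def
        by (simp only: Re_divide_of_real times_complex.sel Re_complex_of_real Im_complex_of_real)
    qed
    ultimately show ?thesis by (simp add: tail_deriv_def)
  qed
  with r show ?thesis by blast
qed

lemma tail_deriv_step:
  assumes "zero_mean c M"
  shows "tail_deriv c M n 0 t = exp (- t) * (c (Suc n) + tail_deriv c M (Suc n) 0 t)"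
proof -
  have "M \<ge> 1" using assms by (simp add: zero_mean_def)
  then have ne: "(\<Sum>i<M. complex_of_real (exp (- t)) ^ i) \<noteq> 0"
    by (intro geometric_sum_of_real_nonzero) auto
  show ?thesis unfolding tail_deriv_def using tail_fun_step[OF assms ne, of n]
    by (simp add: exp_of_real flip: of_real_minus)
qed

lemma expsum_eq_tails:
  assumes "zero_mean c M" "c 0 = 0"
  shows "expsum c n t = tail_deriv c M 0 0 t - exp (- (real n * t)) * tail_deriv c M n 0 t"
proof (induction n)
  case 0
  then show ?case using assms by (simp add: expsum_def)
next
  case (Suc n)
  have "expsum c (Suc n) t = expsum c n t + c (Suc n) * exp (- (real (Suc n) * t))"
    by (simp add: expsum_def)
  also have "\<dots> = tail_deriv c M 0 0 t - exp (- (real n * t)) * tail_deriv c M n 0 t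
      + c (Suc n) * exp (- (real (Suc n) * t))"
    by (simp add: Suc)
  also have "\<dots> = tail_deriv c M 0 0 t - exp (- (real (Suc n) * t)) * tail_deriv c M (Suc n) 0 t"
    unfolding tail_deriv_step[OF assms(1), of n]
    by (simp add: algebra_simps exp_add exp_diff exp_minus field_simps)
  finally show ?case .
qed

text \<open>
Periodicity leaves only finitely many different tails, which makes bounds uniform in \<open>n\<close>.
\<close>

lemma tail_deriv_mod:
  assumes "zero_mean c M"
  shows "tail_deriv c M n = tail_deriv c M (n mod M)"
proof -
  have per: "c (k + m * M) = c k" if "k \<ge> 1" for k m
  proof (induction m)
    case (Suc m)
    have "c ((k + m * M) + M) = c (k + m * M)"
      using assms that by (simp add: zero_mean_def)
    with Suc show ?case by (simp add: algebra_simps)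
  qed simp
  have "(\<Sum>l=1..i. c (n + l)) = (\<Sum>l=1..i. c (n mod M + l))" for i
  proof (rule sum.cong)
    fix l assume "l \<in> {1..i}"
    moreover have "n + l = (n mod M + l) + (n div M) * M"
      using mod_div_mult_eq[of n M] by linarith
    ultimately show "c (n + l) = c (n mod M + l)" using per[of "n mod M + l" "n div M"] by simp
  qed simp
  then show ?thesis unfolding tail_deriv_def[abs_def] tail_fun_def[abs_def] by simp
qed

lemma tail_deriv_series:
  assumes "zero_mean c M" "c 0 = 0" "t > 0"
  shows "(\<lambda>k. c k * exp (- (real k * t))) sums tail_deriv c M 0 0 t"
proof -
  let ?B = "\<Sum>r<M. \<bar>tail_deriv c M r 0 t\<bar>"
  have M: "M \<ge> 1" using assms by (simp add: zero_mean_def)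
  have B: "\<bar>tail_deriv c M n 0 t\<bar> \<le> ?B" for n
    unfolding tail_deriv_mod[OF assms(1), of n] 
    by (rule member_le_sum[of _ _ "\<lambda>r. \<bar>tail_deriv c M r 0 t\<bar>"]) (use M in auto)
  have "(\<lambda>n. exp (- (real n * t))) \<longlonglongrightarrow> 0"
    using LIMSEQ_power_zero[of "exp (- t)"] assms(3) by (simp add: exp_of_nat_mult mult.commute[of _ t] flip: exp_of_nat2_mult)
  then have 0: "(\<lambda>n. exp (- (real n * t)) * ?B) \<longlonglongrightarrow> 0"
    by (rule tendsto_mult_left_zero)
  have "(\<lambda>n. exp (- (real n * t)) * tail_deriv c M n 0 t) \<longlonglongrightarrow> 0"
    by (rule Lim_null_comparison[OF always_eventually 0]) (auto simp: abs_mult intro!: mult_left_mono B)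
  then have "(\<lambda>n. tail_deriv c M 0 0 t - exp (- (real n * t)) * tail_deriv c M n 0 t) \<longlonglongrightarrow> tail_deriv c M 0 0 t - 0"
    by (intro tendsto_intros)
  then show ?thesis
    unfolding sums_def_le expsum_eq_tails[OF assms(1,2), symmetric] expsum_def by simp
qed

section \<open>Limits of moments\<close>

lemma sums_of_uniform_tails:
  fixes a :: "nat \<Rightarrow> nat \<Rightarrow> real"
  assumes a: "\<And>k. (\<lambda>j. a j k) \<longlonglongrightarrow> b k" and L: "L \<longlonglongrightarrow> l"
    and tails: "\<And>K j. K \<ge> 1 \<Longrightarrow> \<bar>(\<Sum>k<K. a j k) - L j\<bar> \<le> C / real K"
  shows "b sums l"
proof -
  have "\<bar>(\<Sum>k<K. b k) - l\<bar> \<le> C / real K" if "K \<ge> 1" for K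
  proof (rule LIMSEQ_le_const2)
    show "(\<lambda>j. \<bar>(\<Sum>k<K. a j k) - L j\<bar>) \<longlonglongrightarrow> \<bar>(\<Sum>k<K. b k) - l\<bar>"
      by (intro tendsto_intros a L)
  qed (use tails that in blast)
  then have "eventually (\<lambda>K. norm ((\<Sum>k<K. b k) - l) \<le> C / real K) sequentially"
    by (intro eventually_sequentiallyI[of 1]) simp
  then have "(\<lambda>K. (\<Sum>k<K. b k) - l) \<longlonglongrightarrow> 0"
    by (rule Lim_null_comparison) (rule lim_const_over_n)
  then show ?thesis unfolding sums_def by (simp add: LIM_zero_iff)
qed

lemma exp_minus_taylor_bound:
  assumes "u \<ge> (0::real)"
  shows "\<bar>exp (- u) - (\<Sum>p<m. (- u) ^ p / fact p)\<bar> \<le> u ^ m / fact m"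
proof (cases "u = 0 \<or> m = 0")
  case True
  then show ?thesis using assms by (cases m) (auto simp: lessThan_Suc_atMost sum.atMost_shift)
next
  case False
  have "\<exists>t. - u < t \<and> t < 0 \<and> exp (- u) = (\<Sum>p<m. exp 0 / fact p * (- u) ^ p) + exp t / fact m * (- u) ^ m"
    using False assms by (intro Maclaurin_minus[where diff = "\<lambda>_. exp"]) auto
  then obtain t where t: "t < 0" "exp (- u) = (\<Sum>p<m. exp 0 / fact p * (- u) ^ p) + exp t / fact m * (- u) ^ m"
    by blast
  then have "\<bar>exp (- u) - (\<Sum>p<m. (- u) ^ p / fact p)\<bar> = exp t * (u ^ m / fact m)"
    using assms by (simp add: abs_mult power_abs)
  also have "\<dots> \<le> 1 * (u ^ m / fact m)"
    using t assms by (intro mult_right_mono) auto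
  finally show ?thesis by simp
qed

text \<open>
By the alternating Taylor bound for \<open>exp (- u)\<close>, the error after \<open>m\<close> Taylor terms is at
most the \<open>m\<close>-th moment times \<open>y ^ m / m!\<close>, which is up to sign the next Taylor term.  It
tends to zero since the Taylor series converges.
\<close>

lemma sums_from_moments:
  fixes b f :: "nat \<Rightarrow> real"
  assumes pos: "\<And>k. k \<ge> 1 \<Longrightarrow> b k \<ge> 0"
    and moments: "\<And>p. (\<lambda>k. b k * (- real k) ^ p * exp (- (real k * t0))) sums f p"
    and taylor: "(\<lambda>p. f p / fact p * y ^ p) sums F" and y: "y \<ge> 0"
  shows "(\<lambda>k. b k * exp (- (real k * (t0 + y)))) sums F"
proof -
  define b0 where "b0 k = b k * exp (- (real k * t0))" for k
  have mom: "(\<lambda>k. b0 k * (- real k) ^ p) sums f p" for p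
    using moments[of p] by (simp add: b0_def mult_ac)
  have pos0: "b0 k \<ge> 0" if "k \<ge> 1" for k using pos[OF that] by (simp add: b0_def)
  have eq: "b k * exp (- (real k * (t0 + y))) = b0 k * exp (- (real k * y))" for k
    by (simp add: b0_def algebra_simps flip: exp_add)
  have "summable b0" using mom[of 0] by (simp add: sums_iff)
  then have sm: "summable (\<lambda>k. b0 k * exp (- (real k * y)))"
    by (rule summable_comparison_test'[where N = 1])
      (use pos0 y in \<open>auto simp: abs_mult intro!: mult_left_le\<close>)
  define G where "G = (\<Sum>k. b0 k * exp (- (real k * y)))"
  have G: "(\<lambda>k. b0 k * exp (- (real k * y))) sums G" using sm by (simp add: G_def sums_iff)
  have bound: "\<bar>G - (\<Sum>p<m. f p / fact p * y ^ p)\<bar> \<le> \<bar>f m / fact m * y ^ m\<bar>" if "m \<ge> 1" for m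
  proof -
    let ?r = "\<lambda>k. b0 k * (exp (- (real k * y)) - (\<Sum>p<m. (- (real k * y)) ^ p / fact p))"
    let ?R = "\<lambda>k. b0 k * ((real k * y) ^ m / fact m)"
    have "(\<lambda>k. b0 k * exp (- (real k * y)) - (\<Sum>p<m. (b0 k * (- real k) ^ p) * (y ^ p / fact p))) sums
       (G - (\<Sum>p<m. f p * (y ^ p / fact p)))"
      by (intro sums_diff G sums_sum sums_mult2 mom)
    moreover have "b0 k * exp (- (real k * y)) - (\<Sum>p<m. (b0 k * (- real k) ^ p) * (y ^ p / fact p)) = ?r k" for k
    proof -
      have "(- (real k * y)) ^ p = (- real k) ^ p * y ^ p" for p
        by (metis mult_minus_left power_mult_distrib)
      then show ?thesis by (simp add: algebra_simps sum_distrib_left)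
    qed
    ultimately have r: "?r sums (G - (\<Sum>p<m. f p / fact p * y ^ p))" by simp
    have "(\<lambda>k. (b0 k * (- real k) ^ m) * ((- y) ^ m / fact m)) sums (f m * ((- y) ^ m / fact m))"
      by (intro sums_mult2 mom)
    moreover have "(b0 k * (- real k) ^ m) * ((- y) ^ m / fact m) = ?R k" for k
      by (simp flip: power_mult_distrib)
    ultimately have R: "?R sums (f m * ((- y) ^ m / fact m))" by (simp only:)
    \<comment> \<open>At index 0 both sides vanish because \<open>m \<ge> 1\<close>; elsewhere \<open>b0\<close> is nonnegative.\<close>
    have rR: "\<bar>?r k\<bar> \<le> ?R k" for k
    proof (cases "k = 0")
      case True
      with that have "?r k = 0"
        using exp_minus_taylor_bound[of 0 m] by (simp add: power_0_left)
      with True that show ?thesis by (simp only: abs_zero) (simp add: power_0_left)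
    next
      case False
      then show ?thesis using exp_minus_taylor_bound[of "real k * y" m] pos0[of k] y
        by (simp only: abs_mult) (auto intro!: mult_left_mono simp del: times_divide_eq_right)
    qed
    have "\<bar>suminf ?r\<bar> \<le> suminf ?R"
      using rR summable_norm_comparison_test sums_summable[OF R] sums_summable[OF r]
      by (intro order.trans[OF summable_rabs suminf_le] summable_rabs_comparison_test[of ?r ?R]) auto
    then have "\<bar>G - (\<Sum>p<m. f p / fact p * y ^ p)\<bar> \<le> f m * ((- y) ^ m / fact m)"
      by (simp only: sums_unique[OF r, symmetric] sums_unique[OF R, symmetric])
    also have "\<dots> \<le> \<bar>f m * ((- y) ^ m / fact m)\<bar>" by (rule abs_ge_self)
    also have "\<dots> = \<bar>f m / fact m * y ^ m\<bar>" by (simp add: abs_mult power_abs)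
    finally show ?thesis .
  qed
  have "(\<lambda>m. f m / fact m * y ^ m) \<longlonglongrightarrow> 0" using taylor by (simp add: sums_iff summable_LIMSEQ_zero)
  then have z: "(\<lambda>m. \<bar>f m / fact m * y ^ m\<bar>) \<longlonglongrightarrow> 0" by (rule tendsto_rabs_zero)
  have "(\<lambda>m. G - (\<Sum>p<m. f p / fact p * y ^ p)) \<longlonglongrightarrow> 0"
    by (rule Lim_null_comparison[OF _ z]) (use bound in \<open>auto intro!: eventually_sequentiallyI[of 1]\<close>)
  moreover have "(\<lambda>m. G - (\<Sum>p<m. f p / fact p * y ^ p)) \<longlonglongrightarrow> G - F"
    using taylor unfolding sums_def by (intro tendsto_intros)
  ultimately have "G = F" using LIMSEQ_unique by force
  with G show ?thesis unfolding eq by simp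
qed

text \<open>
After division by \<open>n ^ q\<close> the contribution of the truncation point \<open>n\<close> is of order
\<open>n ^ (p - q)\<close>, so for \<open>q > p\<close> the truncated series behaves like the full periodic
series, even when \<open>u j\<close> tends to 0 at a rate comparable to \<open>1 / n j\<close>.
\<close>

lemma weighted_expsum_limit:
  assumes c: "zero_mean c M" "c 0 = 0" and n: "filterlim n at_top sequentially"
    and u: "u \<longlonglongrightarrow> t0" "\<And>j. u j \<ge> 0" and pq: "p < q"
  shows "(\<lambda>j. expsum (\<lambda>k. weight (n j) p q k * c k) (n j) (u j) / real (n j) ^ q) \<longlonglongrightarrow> tail_deriv c M 0 p t0"
proof -
  have M: "M \<ge> 1" using c by (simp add: zero_mean_def)
  note fam = deriv_family_tail_deriv[OF M]
  have N: "filterlim (\<lambda>j. real (n j)) at_infinity sequentially"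
    using n by (intro filterlim_at_top_imp_at_infinity filterlim_compose[OF filterlim_real_sequentially])
  then have N': "filterlim (\<lambda>j. - real (n j)) at_infinity sequentially"
    by (auto simp: filterlim_at_infinity_conv_norm_at_top)
  let ?R = "\<lambda>j. exp (- (real (n j) * u j)) * shifted (- real (n j)) p (tail_deriv c M (n j)) q (u j) / real (n j) ^ q"
  let ?B = "\<lambda>j. (\<Sum>r<M. \<bar>shifted (- real (n j)) p (tail_deriv c M r) q (u j) / (- real (n j)) ^ p\<bar>) * inverse (real (n j)) ^ (q - p)"
  have "?B \<longlonglongrightarrow> (\<Sum>r<M. \<bar>tail_deriv c M r q t0\<bar>) * 0 ^ (q - p)"
    by (intro tendsto_intros shifted_limit fam u N' filterlim_compose[OF tendsto_inverse_0 N])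
  moreover have "(\<Sum>r<M. \<bar>tail_deriv c M r q t0\<bar>) * 0 ^ (q - p) = 0" using pq by (simp add: power_0_left)
  ultimately have B: "?B \<longlonglongrightarrow> 0" by (simp only:)
  have "eventually (\<lambda>j. norm (?R j) \<le> ?B j) sequentially"
    using eventually_compose_filterlim[OF eventually_ge_at_top[of 1] n]
  proof eventually_elim
    case (elim j)
    let ?X = "shifted (- real (n j)) p (tail_deriv c M (n j)) q (u j)"
    have qp: "real (n j) ^ q = real (n j) ^ p * real (n j) ^ (q - p)"
      using pq by (simp flip: power_add)
    have "norm (?R j) = exp (- (real (n j) * u j)) * \<bar>?X / (- real (n j)) ^ p\<bar> * inverse (real (n j)) ^ (q - p)"
      unfolding qp using elim by (simp add: abs_mult power_abs field_simps)
    also have "\<dots> \<le> 1 * \<bar>?X / (- real (n j)) ^ p\<bar> * inverse (real (n j)) ^ (q - p)"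
      using u(2) by (intro mult_right_mono) auto
    also have "\<dots> \<le> ?B j"
      unfolding tail_deriv_mod[OF c(1), of "n j"] mult_1
      by (intro mult_right_mono member_le_sum[of _ _ "\<lambda>r. \<bar>shifted (- real (n j)) p (tail_deriv c M r) q (u j) / (- real (n j)) ^ p\<bar>"]) (use M in auto)
    finally show ?case .
  qed
  then have R: "?R \<longlonglongrightarrow> 0" using B by (rule Lim_null_comparison)
  have "(\<lambda>j. shifted (real (n j)) q (tail_deriv c M 0) p (u j) / real (n j) ^ q - ?R j) \<longlonglongrightarrow> tail_deriv c M 0 p t0 - 0"
    by (intro tendsto_intros shifted_limit fam u N R)
  moreover have "expsum (\<lambda>k. weight (n j) p q k * c k) (n j) (u j) / real (n j) ^ q = 
    shifted (real (n j)) q (tail_deriv c M 0) p (u j) / real (n j) ^ q - ?R j" for j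
    by (subst weighted_expsum_closed_form[OF fam fam expsum_eq_tails[OF c]]) (simp add: diff_divide_distrib)
  ultimately show ?thesis by simp
qed

text \<open>
A zero of the weighted sum says that the \<open>p\<close>-th moment of the excess \<open>e j - c\<close> is the negative
of a quantity that converges.  The excess is nonnegative away from index 0, so the moment of
order \<open>p + 1\<close>, which converges along the zeros \<open>t' j\<close> and is therefore bounded, forces the tail
beyond \<open>K\<close> to be at most \<open>C / K\<close> and no mass escapes to infinity.  The order \<open>p + 2\<close> is
the smallest one exceeding both \<open>p\<close> and \<open>p + 1\<close>.
\<close>

lemma limit_moments:
  fixes e :: "nat \<Rightarrow> nat \<Rightarrow> real"
  assumes c: "zero_mean c M" "c 0 = 0" and n: "filterlim n at_top sequentially"
    and ge: "\<And>j k. 1 \<le> k \<Longrightarrow> k \<le> n j \<Longrightarrow> c k \<le> e j k"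
    and lim: "\<And>k. (\<lambda>j. e j k) \<longlonglongrightarrow> a k"
    and t: "t \<longlonglongrightarrow> t0" "t' \<longlonglongrightarrow> t0" "\<And>j. 0 \<le> t' j" "\<And>j. t' j \<le> t j"
    and zero: "\<And>j. expsum (\<lambda>k. weight (n j) p (p + 2) k * e j k) (n j) (t j) = 0"
    and zero': "\<And>j. expsum (\<lambda>k. weight (n j) (Suc p) (p + 2) k * e j k) (n j) (t' j) = 0"
  shows "(\<lambda>k. (a k - c k) * (- real k) ^ p * exp (- (real k * t0))) sums - tail_deriv c M 0 p t0"
proof -
  define q where "q = p + 2"
  define w where "w i j u k = (if k \<le> n j then weight (n j) i q k / real (n j) ^ q * (e j k - c k) * exp (- (real k * u)) else 0)" 
    for i j k u
  define L where "L i j u = (\<Sum>k\<le>n j. w i j u k)" for i j u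
  have L: "L i j u = (expsum (\<lambda>k. weight (n j) i q k * e j k) (n j) u - expsum (\<lambda>k. weight (n j) i q k * c k) (n j) u) / real (n j) ^ q" for i j u
    by (simp add: L_def w_def expsum_def sum_subtractf[symmetric] sum_divide_distrib algebra_simps diff_divide_distrib)
  have t0: "0 \<le> t j" for j using t(3,4) order.trans by blast
  have limL: "(\<lambda>j. L p j (t j)) \<longlonglongrightarrow> - tail_deriv c M 0 p t0"
    using tendsto_minus[OF weighted_expsum_limit[OF c n t(1) t0, of p q]] zero
    by (simp add: L q_def)
  have limL': "(\<lambda>j. L (Suc p) j (t' j)) \<longlonglongrightarrow> - tail_deriv c M 0 (Suc p) t0"
    using tendsto_minus[OF weighted_expsum_limit[OF c n t(2) t(3), of "Suc p" q]] zero'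
    by (simp add: L q_def)
  from limL' obtain C where C: "\<And>j. \<bar>L (Suc p) j (t' j)\<bar> \<le> C"
    using convergent_imp_Bseq[OF convergentI] by (force simp: Bseq_def)
  show ?thesis
  proof (rule sums_of_uniform_tails[where a = "\<lambda>j. w p j (t j)" and C = C])
    fix k
    have ev: "eventually (\<lambda>j. k \<le> n j \<and> 1 \<le> n j) sequentially"
      using eventually_compose_filterlim[OF eventually_ge_at_top[of "max k 1"] n] by (rule eventually_mono) auto
    have "(\<lambda>j. 1 / real (n j)) \<longlonglongrightarrow> 0"
      using filterlim_compose[OF lim_1_over_n n] by simp
    then have "(\<lambda>j. (- real k) ^ p * (1 - real k * (1 / real (n j))) ^ q * (e j k - c k) * exp (- (real k * t j))) \<longlonglongrightarrow> 
      (- real k) ^ p * (1 - real k * 0) ^ q * (a k - c k) * exp (- (real k * t0))"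
      by (intro tendsto_intros lim t)
    moreover have "eventually (\<lambda>j. (- real k) ^ p * (1 - real k * (1 / real (n j))) ^ q * (e j k - c k) * exp (- (real k * t j)) = w p j (t j) k) sequentially"
      using ev
    proof eventually_elim
      case (elim j)
      then have "(1 - real k * (1 / real (n j))) ^ q = (real (n j) - real k) ^ q / real (n j) ^ q"
        by (simp add: diff_divide_distrib flip: power_divide)
      then show ?case using elim by (simp add: w_def weight_def)
    qed
    ultimately have "(\<lambda>j. w p j (t j) k) \<longlonglongrightarrow> (- real k) ^ p * (1 - real k * 0) ^ q * (a k - c k) * exp (- (real k * t0))"
      by (rule Lim_transform_eventually)
    then show "(\<lambda>j. w p j (t j) k) \<longlonglongrightarrow> (a k - c k) * (- real k) ^ p * exp (- (real k * t0))"
      by (simp add: mult.commute)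
  next
    show "(\<lambda>j. L p j (t j)) \<longlonglongrightarrow> - tail_deriv c M 0 p t0" by (rule limL)
  next
    fix K j :: nat assume K: "K \<ge> 1"
    have w_abs: "\<bar>w i j u k\<bar> = real k ^ i * ((real (n j) - real k) / real (n j)) ^ q * (e j k - c k) * exp (- (real k * u))"
      if "k \<in> {1..n j}" for i u k
      using that ge[of k j] by (simp add: w_def weight_def abs_mult power_abs power_divide)
    have w_sgn: "w i j u k = (- 1) ^ i * \<bar>w i j u k\<bar>" if "k \<in> {1..n j}" for i u k
      unfolding w_abs[OF that] using that
      by (simp add: w_def weight_def power_divide power_minus[of "real k"])
    have step: "\<bar>w p j (t j) k\<bar> * real k \<le> \<bar>w (Suc p) j (t' j) k\<bar>" if "k \<in> {1..n j}" for k
      unfolding w_abs[OF that] using that ge[of k j] t(4)[of j]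
      by (auto simp: mult_ac intro!: mult_left_mono mult_right_mono)
    have "(\<Sum>k<K. w p j (t j) k) - L p j (t j) = - (\<Sum>k\<in>{K..n j}. w p j (t j) k)"
    proof -
      have "L p j (t j) = (\<Sum>k\<in>{..n j} \<union> {..<K}. w p j (t j) k)"
        unfolding L_def by (rule sum.mono_neutral_left) (auto simp: w_def)
      also have "{..n j} \<union> {..<K} = {..<K} \<union> {K..n j}" by auto
      also have "(\<Sum>k\<in>\<dots>. w p j (t j) k) = (\<Sum>k<K. w p j (t j) k) + (\<Sum>k\<in>{K..n j}. w p j (t j) k)"
        by (rule sum.union_disjoint) auto
      finally show ?thesis by simp
    qed
    then have "\<bar>(\<Sum>k<K. w p j (t j) k) - L p j (t j)\<bar> * K \<le> (\<Sum>k\<in>{K..n j}. \<bar>w p j (t j) k\<bar>) * K"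
      by (intro mult_right_mono) (auto intro: sum_abs)
    also have "\<dots> \<le> (\<Sum>k\<in>{K..n j}. \<bar>w (Suc p) j (t' j) k\<bar>)"
      unfolding sum_distrib_right
    proof (rule sum_mono)
      fix k assume k: "k \<in> {K..n j}"
      then have "\<bar>w p j (t j) k\<bar> * real K \<le> \<bar>w p j (t j) k\<bar> * real k"
        by (intro mult_left_mono) auto
      also have "\<dots> \<le> \<bar>w (Suc p) j (t' j) k\<bar>" using k K by (intro step) auto
      finally show "\<bar>w p j (t j) k\<bar> * real K \<le> \<bar>w (Suc p) j (t' j) k\<bar>" .
    qed
    also have "\<dots> \<le> (\<Sum>k\<in>{1..n j}. \<bar>w (Suc p) j (t' j) k\<bar>)"
      using K by (intro sum_mono2) auto
    also have "\<dots> = \<bar>\<Sum>k\<in>{1..n j}. w (Suc p) j (t' j) k\<bar>"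
    proof -
      have "(\<Sum>k\<in>{1..n j}. w (Suc p) j (t' j) k) = (- 1) ^ Suc p * (\<Sum>k\<in>{1..n j}. \<bar>w (Suc p) j (t' j) k\<bar>)"
        unfolding sum_distrib_left by (intro sum.cong w_sgn) auto
      then show ?thesis by (simp add: abs_mult power_abs sum_nonneg)
    qed
    also have "(\<Sum>k\<in>{1..n j}. w (Suc p) j (t' j) k) = L (Suc p) j (t' j)"
      unfolding L_def by (rule sum.mono_neutral_left) (auto simp: w_def weight_def)
    also have "\<bar>\<dots>\<bar> \<le> C" by (rule C)
    finally show "\<bar>(\<Sum>k<K. w p j (t j) k) - L p j (t j)\<bar> \<le> C / real K"
      using K by (simp add: pos_le_divide_eq)
  qed
qed

section \<open>Clustering zeros\<close>

text \<open>
Otherwise finitely many balls cover \<open>K\<close>, each meeting every member of the family in a bounded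
number of points.
\<close>

lemma cluster_point_of_large_sets:
  fixes K :: "'a :: metric_space set"
  assumes K: "compact K" and F: "\<And>Z. Z \<in> F \<Longrightarrow> finite Z \<and> Z \<subseteq> K"
    and large: "\<And>r. \<exists>Z\<in>F. r \<le> card Z"
  shows "\<exists>x\<in>K. \<forall>\<epsilon>>0. \<forall>r. \<exists>Z\<in>F. r \<le> card (Z \<inter> ball x \<epsilon>)"
proof (rule ccontr)
  assume "\<not> ?thesis"
  then have "\<forall>x\<in>K. \<exists>\<epsilon>>0. \<exists>r. \<forall>Z\<in>F. card (Z \<inter> ball x \<epsilon>) < r" by (metis not_le)
  then obtain \<epsilon> r where er: "\<And>x. x \<in> K \<Longrightarrow> \<epsilon> x > 0" "\<And>x Z. x \<in> K \<Longrightarrow> Z \<in> F \<Longrightarrow> card (Z \<inter> ball x (\<epsilon> x)) < r x"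
    by metis
  obtain C where C: "C \<subseteq> K" "finite C" "K \<subseteq> (\<Union>x\<in>C. ball x (\<epsilon> x))"
    by (rule compactE_image[OF K, of K "\<lambda>x. ball x (\<epsilon> x)"]) (use er(1) in force)+
  obtain Z where Z: "Z \<in> F" "Suc (\<Sum>x\<in>C. r x) \<le> card Z" using large by blast
  have "Z = (\<Union>x\<in>C. Z \<inter> ball x (\<epsilon> x))" using C F[OF Z(1)] by auto
  then have "card Z \<le> (\<Sum>x\<in>C. card (Z \<inter> ball x (\<epsilon> x)))"
    using card_UN_le[OF C(2)] by metis
  also have "\<dots> \<le> (\<Sum>x\<in>C. r x)" using er(2) C(1) Z(1) by (intro sum_mono less_imp_le) auto
  finally show False using Z(2) by simp
qed

lemma power_series_vanishing_on_interval:
  fixes a :: "nat \<Rightarrow> real"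
  assumes a: "\<And>k. \<bar>a k\<bar> \<le> A" and uv: "0 \<le> u" "u < v" "v \<le> 1"
    and zero: "\<And>x. u < x \<Longrightarrow> x < v \<Longrightarrow> (\<lambda>k. a k * x ^ k) sums 0"
  shows "a 0 = 0"
proof -
  let ?f = "\<lambda>z. \<Sum>k. complex_of_real (a k) * z ^ k"
  have sums: "(\<lambda>k. complex_of_real (a k) * z ^ k) sums ?f z" if "z \<in> ball 0 1" for z
  proof (rule summable_sums, rule summable_comparison_test')
    show "summable (\<lambda>k. A * norm z ^ k)" using that by (intro summable_mult summable_geometric) auto
    show "norm (complex_of_real (a k) * z ^ k) \<le> A * norm z ^ k" for k
      using a by (auto simp: norm_mult norm_power intro!: mult_right_mono)
  qed
  have hol: "?f holomorphic_on ball 0 1"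
    by (rule power_series_holomorphic[where a = "\<lambda>k. complex_of_real (a k)"]) (use sums in simp)
  let ?U = "complex_of_real ` {u<..<v}" and ?m = "complex_of_real ((u + v) / 2)"
  have lp: "?m islimpt ?U"
    unfolding islimpt_approachable
  proof (intro allI impI)
    fix d :: real assume d: "d > 0"
    define h where "h = min (d / 2) ((v - u) / 4)"
    have h: "h > 0" "h < d" "(u + v) / 2 + h < v" "u < (u + v) / 2 + h"
      using d uv by (auto simp: h_def min_def field_simps)
    have "complex_of_real ((u + v) / 2 + h) \<in> ?U" using h by (intro imageI) auto
    moreover have "dist (complex_of_real ((u + v) / 2 + h)) ?m < d"
    proof -
      have "dist ((u + v) / 2 + h) ((u + v) / 2) < d" using h by (simp add: dist_real_def)
      then show ?thesis by (simp only: dist_of_real)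
    qed
    moreover have "complex_of_real ((u + v) / 2 + h) \<noteq> ?m" using h by (simp only: of_real_eq_iff)
    ultimately show "\<exists>x'\<in>?U. x' \<noteq> ?m \<and> dist x' ?m < d" by blast
  qed
  have fU: "?f z = 0" if "z \<in> ?U" for z
  proof -
    from that obtain x where x: "z = of_real x" "u < x" "x < v" by auto
    from sums_of_real[OF zero[OF x(2,3)], where ?'a = complex] show ?thesis
      by (simp add: x(1) sums_iff)
  qed
  have "?f 0 = 0"
    by (rule analytic_continuation[OF hol _ _ _ _ lp fU]) (use uv in \<open>auto simp flip: of_real_add\<close>)
  moreover have "(\<lambda>k. complex_of_real (a k) * 0 ^ k) sums ?f 0" by (rule sums) simp
  ultimately show ?thesis by simp
qed

lemma card_expsum_zeros_le:
  assumes "a 0 \<noteq> 0" "finite Z" "\<And>z. z \<in> Z \<Longrightarrow> expsum a n z = 0"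
  shows "card Z \<le> n"
proof -
  have inj: "inj_on (\<lambda>t::real. exp (- t)) Z" by (auto simp: inj_on_def)
  note rb = polyfun_rootbound[of n a]
  have "(\<lambda>t. exp (- t)) ` Z \<subseteq> {x. (\<Sum>k\<le>n. a k * x ^ k) = 0}"
    using assms(3) by (auto simp: expsum_def simp flip: exp_of_nat_mult)
  then have "card ((\<lambda>t. exp (- t)) ` Z) \<le> n" using rb assms(1) by (meson card_mono le0 order.trans)
  then show ?thesis using card_image[OF inj] by simp
qed

text \<open>
Roots stay away from 0, so that \<open>t = - ln x\<close> ranges over a compact interval.
\<close>

lemma root_lower_bound:
  fixes x :: real
  assumes e: "e 0 = s" "s \<noteq> 0" "\<And>k. \<bar>e k\<bar> \<le> A" and x: "0 \<le> x" "x \<le> 1" "(\<Sum>k\<le>n. e k * x ^ k) = 0"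
  shows "\<bar>s\<bar> / (\<bar>s\<bar> + A) \<le> x"
proof -
  have A: "A \<ge> 0" using e(3)[of 0] by linarith
  have "(\<Sum>k\<le>n. e k * x ^ k) = s + x * (\<Sum>k<n. e (Suc k) * x ^ k)"
    by (simp add: sum.atMost_shift e sum_distrib_left mult_ac)
  then have "\<bar>s\<bar> = x * \<bar>\<Sum>k<n. e (Suc k) * x ^ k\<bar>"
    using x by (metis abs_minus_cancel abs_mult abs_of_nonneg eq_neg_iff_add_eq_0)
  also have "\<dots> \<le> x * (\<Sum>k<n. A * x ^ k)"
    using x e by (intro mult_left_mono order.trans[OF sum_abs] sum_mono) (auto simp: abs_mult intro!: mult_right_mono)
  finally have "\<bar>s\<bar> * (1 - x) \<le> x * (\<Sum>k<n. A * x ^ k) * (1 - x)"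
    using x by (intro mult_right_mono) auto
  also have "\<dots> = x * A * ((1 - x) * (\<Sum>k<n. x ^ k))"
    by (simp add: sum_distrib_left[symmetric])
  also have "\<dots> = x * A * (1 - x ^ n)" by (simp add: one_diff_power_eq)
  also have "\<dots> \<le> x * A * 1" using x A by (intro mult_left_mono) auto
  finally show ?thesis using e(2) A by (simp add: field_simps)
qed

definition admissible :: "(nat \<Rightarrow> real) \<Rightarrow> real \<Rightarrow> real \<Rightarrow> nat \<Rightarrow> (nat \<Rightarrow> real) \<Rightarrow> bool" where
  "admissible c s A n e \<longleftrightarrow> e 0 = s \<and> (\<forall>k. \<bar>e k\<bar> \<le> A) \<and> (\<forall>k\<in>{1..n}. c k \<le> e k)"

text \<open>
A coefficientwise limit \<open>a\<close> of the given sums has excess \<open>a - c\<close> whose moments at \<open>t0\<close> are the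
negatives of the derivatives of the analytic continuation of the series of \<open>c\<close>.  Since moments and
Taylor coefficients determine both functions to the right of \<open>t0\<close>, the series with coefficients
\<open>a\<close> vanishes there, and thus identically, although its constant term is \<open>s \<noteq> 0\<close>.
\<close>

lemma no_clustering_sequence:
  assumes c: "zero_mean c M" "c 0 = 0" and s: "s \<noteq> 0" and t0: "t0 \<ge> 0"
    and adm: "\<And>j. admissible c s A (n j) (e j)"
    and Z: "\<And>j. finite (Z j)" "\<And>j. j \<le> card (Z j)" "\<And>j z. z \<in> Z j \<Longrightarrow> expsum (e j) (n j) z = 0"
    and near: "\<And>j. Z j \<subseteq> {0..} \<inter> ball t0 (1 / real (Suc j))"
  shows False
proof -
  have M: "M \<ge> 1" using c by (simp add: zero_mean_def)
  have e: "e j 0 = s" "\<bar>e j k\<bar> \<le> A" "1 \<le> k \<Longrightarrow> k \<le> n j \<Longrightarrow> c k \<le> e j k" for j k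
    using adm[of j] by (auto simp: admissible_def)
  have n_ge: "j \<le> n j" for j
    using card_expsum_zeros_le[of "e j" "Z j" "n j"] Z e(1) s by (metis order.trans)
  then have n_top: "filterlim n at_top sequentially"
    by (intro filterlim_at_top_mono[OF filterlim_ident]) auto
  obtain h where h: "strict_mono (h :: nat \<Rightarrow> nat)" "\<And>k. k \<in> UNIV \<Longrightarrow> \<exists>l. (\<lambda>j. e (h j) k) \<longlonglongrightarrow> l"
    by (rule function_convergent_subsequence[of "UNIV :: nat set" e A]) (use e(2) in auto)
  then obtain a where a: "\<And>k. (\<lambda>j. e (h j) k) \<longlonglongrightarrow> a k" by (metis UNIV_I)
  have h_ge: "j \<le> h j" for j using h(1) by (rule strict_mono_imp_increasing)
  have h_top: "filterlim h at_top sequentially" using h(1) by (rule filterlim_subseq)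
  have moments: "(\<lambda>k. (a k - c k) * (- real k) ^ p * exp (- (real k * t0))) sums - tail_deriv c M 0 p t0" for p
  proof -
    \<comment> \<open>Dropping \<open>2 * p + 4\<close> terms leaves enough zeros for \<open>p + (p + 2)\<close> Rolle steps and a final pair.\<close>
    define g where "g j = h (j + (2 * p + 4))" for j
    have g_ge: "j + (2 * p + 4) \<le> g j" for j using h_ge by (simp add: g_def)
    have g_top: "filterlim g at_top sequentially"
      unfolding g_def by (rule filterlim_compose[OF h_top filterlim_add_const_nat_at_top])
    define Q where "Q j t' t \<longleftrightarrow> max 0 (t0 - 1 / real (Suc (g j))) \<le> t' \<and> t' < t \<and> t \<le> t0 + 1 / real (Suc (g j)) \<and>
       expsum (\<lambda>k. weight (n (g j)) p (p + 2) k * e (g j) k) (n (g j)) t = 0 \<and>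
       expsum (\<lambda>k. weight (n (g j)) (Suc p) (p + 2) k * e (g j) k) (n (g j)) t' = 0" for j t' t
    have "\<exists>t' t. Q j t' t" for j
      unfolding Q_def
    proof (rule expsum_zero_pair[OF Z(1)])
      show "2 + p + (p + 2) \<le> card (Z (g j))"
        using g_ge[of j] Z(2)[of "g j"] by linarith
      show "Z (g j) \<subseteq> {max 0 (t0 - 1 / real (Suc (g j)))..t0 + 1 / real (Suc (g j))}"
      proof
        fix x assume "x \<in> Z (g j)"
        then have "0 \<le> x" "\<bar>t0 - x\<bar> < 1 / real (Suc (g j))"
          using near[of "g j"] by (auto simp: dist_real_def simp del: of_nat_Suc)
        then show "x \<in> {max 0 (t0 - 1 / real (Suc (g j)))..t0 + 1 / real (Suc (g j))}"
          unfolding atLeastAtMost_iff max.bounded_iff by linarith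
      qed
    qed (use Z(3) in auto)
    then obtain t' t where "\<And>j. Q j (t' j) (t j)" by metis
    then have t: "\<And>j. 0 \<le> t' j" "\<And>j. t0 - 1 / real (Suc (g j)) \<le> t' j" "\<And>j. t' j < t j" 
      "\<And>j. t j \<le> t0 + 1 / real (Suc (g j))"
      "\<And>j. expsum (\<lambda>k. weight (n (g j)) p (p + 2) k * e (g j) k) (n (g j)) (t j) = 0"
      "\<And>j. expsum (\<lambda>k. weight (n (g j)) (Suc p) (p + 2) k * e (g j) k) (n (g j)) (t' j) = 0"
      unfolding Q_def max.bounded_iff by blast+
    have inv: "(\<lambda>j. 1 / real (Suc (g j))) \<longlonglongrightarrow> 0"
      using filterlim_compose[OF LIMSEQ_inverse_real_of_nat g_top] by (simp add: inverse_eq_divide)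
    have lo: "(\<lambda>j. t0 - 1 / real (Suc (g j))) \<longlonglongrightarrow> t0" and hi: "(\<lambda>j. t0 + 1 / real (Suc (g j))) \<longlonglongrightarrow> t0"
      using tendsto_diff[OF tendsto_const inv, of t0] tendsto_add[OF tendsto_const inv, of t0] by simp_all
    have lt: "t \<longlonglongrightarrow> t0" "t' \<longlonglongrightarrow> t0"
      by (rule tendsto_sandwich[OF _ _ lo hi]; use t(2-4) in \<open>intro always_eventually allI; meson order.trans less_imp_le\<close>)+
    show ?thesis
    proof (rule limit_moments[where n = "\<lambda>j. n (g j)" and e = "\<lambda>j. e (g j)" and t = t and t' = t', OF c])
      show "filterlim (\<lambda>j. n (g j)) at_top sequentially" by (rule filterlim_compose[OF n_top g_top])
      show "(\<lambda>j. e (g j) k) \<longlonglongrightarrow> a k" for k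
        unfolding g_def using LIMSEQ_ignore_initial_segment[OF a[of k], of "2 * p + 4"] .
    qed (use e lt t in \<open>auto intro: less_imp_le\<close>)
  qed
  have a_ge: "a k \<ge> c k" if "k \<ge> 1" for k
  proof (rule tendsto_lowerbound[OF a[of k]])
    have "k \<le> n (h j)" if "j \<ge> k" for j using that h_ge[of j] n_ge[of "h j"] by linarith
    then show "eventually (\<lambda>j. c k \<le> e (h j) k) sequentially"
      using e(3) that by (intro eventually_sequentiallyI[of k]) auto
  qed simp
  obtain r where r: "r > 0" "\<And>y. \<bar>y\<bar> < r \<Longrightarrow> (\<lambda>p. tail_deriv c M 0 p t0 / fact p * y ^ p) sums tail_deriv c M 0 0 (t0 + y)"
    using tail_deriv_taylor[OF M] by blast
  have zero: "(\<lambda>k. a k * exp (- (real k * (t0 + y)))) sums 0" if y: "0 < y" "y < r" for y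
  proof -
    have "(\<lambda>p. - tail_deriv c M 0 p t0 / fact p * y ^ p) sums - tail_deriv c M 0 0 (t0 + y)"
      using sums_minus[OF r(2)[of y]] y by simp
    from sums_from_moments[OF _ moments this] a_ge y
    have "(\<lambda>k. (a k - c k) * exp (- (real k * (t0 + y)))) sums - tail_deriv c M 0 0 (t0 + y)"
      by simp
    from sums_add[OF this tail_deriv_series[OF c, of "t0 + y"]] show ?thesis
      using y t0 by (simp add: algebra_simps)
  qed
  have "a 0 = 0"
  proof (rule power_series_vanishing_on_interval)
    show "\<bar>a k\<bar> \<le> A" for k
      using LIMSEQ_le_const2[OF tendsto_rabs[OF a[of k]]] e(2) by blast
    show "exp (- (t0 + r)) < exp (- t0)" using r by simp
    show "(\<lambda>k. a k * x ^ k) sums 0" if "exp (- (t0 + r)) < x" "x < exp (- t0)" for x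
    proof -
      have x: "x > 0" using that(1) exp_gt_zero order.strict_trans by blast
      define y where "y = - ln x - t0"
      have "ln x < - t0" using that(2) x by (metis ln_exp ln_less_cancel_iff exp_gt_zero)
      moreover have "- (t0 + r) < ln x" using that(1) x by (metis ln_exp ln_less_cancel_iff exp_gt_zero)
      ultimately have "0 < y" "y < r" by (auto simp: y_def)
      from zero[OF this] have "(\<lambda>k. a k * exp (real k * ln x)) sums 0" by (simp add: y_def)
      then show ?thesis using x by (simp add: exp_of_nat_mult)
    qed
  qed (use t0 in auto)
  moreover have "a 0 = s" using a[of 0] by (simp add: e(1) LIMSEQ_const_iff)
  ultimately show False using s by simp
qed

text \<open>
In the variable \<open>t = - ln x\<close> the point \<open>x = 1\<close> becomes \<open>t = 0\<close>.  Unbounded numbers of roots in a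
compact interval have to cluster at some point, and the clustering lemma excludes this.
\<close>

lemma admissible_roots_bounded:
  assumes c: "zero_mean c M" "c 0 = 0" and s: "s \<noteq> 0"
  shows "\<exists>r. \<forall>n e X. admissible c s A n e \<longrightarrow> finite X \<longrightarrow> X \<subseteq> {0..1} \<longrightarrow>
    (\<forall>x\<in>X. (\<Sum>k\<le>n. e k * x ^ k) = 0) \<longrightarrow> card X < r"
proof (rule ccontr)
  assume "\<not> ?thesis"
  then have large: "\<exists>n e X. admissible c s A n e \<and> finite X \<and> X \<subseteq> {0..1} \<and>
      (\<forall>x\<in>X. (\<Sum>k\<le>n. e k * x ^ k) = 0) \<and> r \<le> card X" for r
    by (simp only: not_ex not_all not_imp not_less simp_thms)
  define T where "T = - ln (\<bar>s\<bar> / (\<bar>s\<bar> + A))"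
  define F where "F = {Z. finite Z \<and> Z \<subseteq> {0..T} \<and> (\<exists>n e. admissible c s A n e \<and> (\<forall>z\<in>Z. expsum e n z = 0))}"
  have "\<exists>t0\<in>{0..T}. \<forall>\<epsilon>>0. \<forall>r. \<exists>Z\<in>F. r \<le> card (Z \<inter> ball t0 \<epsilon>)"
  proof (rule cluster_point_of_large_sets)
    fix r
    obtain n e X where X: "admissible c s A n e" "finite X" "X \<subseteq> {0..1}"
      "\<forall>x\<in>X. (\<Sum>k\<le>n. e k * x ^ k) = 0" "r \<le> card X"
      using large[of r] by (elim exE conjE)
    have e: "e 0 = s" "\<And>k. \<bar>e k\<bar> \<le> A" using X(1) by (auto simp: admissible_def)
    have A: "A \<ge> 0" using e(2)[of 0] by linarith
    have q: "\<bar>s\<bar> / (\<bar>s\<bar> + A) > 0" using s A by simp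
    have low: "\<bar>s\<bar> / (\<bar>s\<bar> + A) \<le> x" if "x \<in> X" for x
      using root_lower_bound[of e s A x n] e s X(3,4) that by auto
    have pos: "x > 0" if "x \<in> X" for x using low[OF that] q by linarith
    define Z where "Z = (\<lambda>x. - ln x) ` X"
    have "inj_on (\<lambda>x. - ln x) X" using pos by (auto simp: inj_on_def)
    then have "card Z = card X" by (simp add: Z_def card_image)
    moreover have "Z \<subseteq> {0..T}"
      using low pos X(3) q by (auto simp: Z_def T_def)
    moreover have "expsum e n z = 0" if "z \<in> Z" for z
    proof -
      from that obtain x where x: "x \<in> X" "z = - ln x" by (auto simp: Z_def)
      show ?thesis using bspec[OF X(4) x(1)] pos[OF x(1)] by (simp add: expsum_def x(2) exp_of_nat_mult)
    qed
    moreover have "finite Z" using X(2) by (simp add: Z_def)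
    ultimately have "Z \<in> F" "r \<le> card Z" using X(1,5) unfolding F_def by auto
    then show "\<exists>Z\<in>F. r \<le> card Z" by blast
  qed (auto simp: F_def)
  then obtain t0 where t0: "t0 \<ge> 0" "\<And>\<epsilon> r. \<epsilon> > 0 \<Longrightarrow> \<exists>Z\<in>F. r \<le> card (Z \<inter> ball t0 \<epsilon>)" by auto
  have "\<exists>Z n e. Z \<in> F \<and> j \<le> card (Z \<inter> ball t0 (1 / real (Suc j))) \<and> admissible c s A n e \<and> (\<forall>z\<in>Z. expsum e n z = 0)" for j
    using t0(2)[of "1 / real (Suc j)" j] unfolding F_def by auto
  then obtain Z n e where Z: "\<And>j. Z j \<in> F" "\<And>j. j \<le> card (Z j \<inter> ball t0 (1 / real (Suc j)))" 
    "\<And>j. admissible c s A (n j) (e j)" "\<And>j z. z \<in> Z j \<Longrightarrow> expsum (e j) (n j) z = 0"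
    by metis
  have fin: "finite (Z j)" and sub: "z \<in> Z j \<Longrightarrow> 0 \<le> z" for j z using Z(1)[of j] by (auto simp: F_def)
  show False
    by (rule no_clustering_sequence[where Z = "\<lambda>j. Z j \<inter> ball t0 (1 / real (Suc j))", OF c s t0(1) Z(3)])
      (use Z(2,4) fin sub in \<open>auto simp del: of_nat_Suc\<close>)
qed

section \<open>Periodic coefficient sets\<close>

lemma zero_meanI:
  assumes "M \<ge> 1" and per: "\<And>k. k \<ge> 1 \<Longrightarrow> c (k + M) = c k" and sum: "(\<Sum>k=1..M. c k) = 0"
  shows "zero_mean c M"
  unfolding zero_mean_def
proof (intro conjI allI impI)
  fix n show "(\<Sum>i=1..M. c (n + i)) = 0"
  proof (induction n)
    case (Suc n)
    have "(\<Sum>i=1..M. c (Suc n + i)) = (\<Sum>i=Suc 1..Suc M. c (n + i))"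
      by (subst sum.shift_bounds_cl_Suc_ivl) simp
    also have "\<dots> = (\<Sum>i=1..Suc M. c (n + i)) - c (n + 1)"
      using sum.atLeast_Suc_atMost[of 1 "Suc M" "\<lambda>i. c (n + i)"] by simp
    also have "\<dots> = (\<Sum>i=1..M. c (n + i))" using per[of "Suc n"] by simp
    finally show ?case using Suc by simp
  qed (use sum in simp)
qed (use assms in auto)

text \<open>
Lowering every \<open>m k\<close> by the mean of a period reduces a nonnegative sum to the sum zero, with the
lower bound preserved.  The constant term \<open>s\<close> may be negative; this is what lets the same
bound serve for the maxima, through the polynomials \<open>- P\<close>.
\<close>

lemma roots_bounded_if_lower_sum_nonneg:
  fixes m :: "nat \<Rightarrow> real"
  assumes M: "M \<ge> 1" and per: "\<And>k. k \<ge> 1 \<Longrightarrow> m (k + M) = m k" and sum: "(\<Sum>k=1..M. m k) \<ge> 0" and s: "s \<noteq> 0"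
  shows "\<exists>r. \<forall>n e X. e 0 = s \<longrightarrow> (\<forall>k\<in>{1..n}. m k \<le> e k \<and> \<bar>e k\<bar> \<le> A) \<longrightarrow> finite X \<longrightarrow> X \<subseteq> {0..1} \<longrightarrow>
    (\<forall>x\<in>X. (\<Sum>k\<le>n. e k * x ^ k) = 0) \<longrightarrow> card X < r"
proof -
  define S where "S = (\<Sum>k=1..M. m k)"
  \<comment> \<open>The series of \<open>c\<close> starts at index 1; the constant term \<open>s\<close> is kept in the excess.\<close>
  define c where "c k = (if k = 0 then 0 else m k - S / real M)" for k
  have "(\<Sum>k=1..M. c k) = (\<Sum>k=1..M. m k - S / real M)" by (rule sum.cong) (auto simp: c_def)
  also have "\<dots> = 0" using M by (simp add: sum_subtractf S_def)
  finally have zm: "zero_mean c M" using M per by (intro zero_meanI) (auto simp: c_def)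
  have c0: "c 0 = 0" by (simp add: c_def)
  have cm: "c k \<le> m k" if "k \<ge> 1" for k using that sum by (simp add: c_def S_def)
  obtain r where r: "\<And>n e X. admissible c s (max \<bar>A\<bar> \<bar>s\<bar>) n e \<Longrightarrow> finite X \<Longrightarrow> X \<subseteq> {0..1} \<Longrightarrow>
    (\<forall>x\<in>X. (\<Sum>k\<le>n. e k * x ^ k) = 0) \<Longrightarrow> card X < r"
    using admissible_roots_bounded[OF zm c0 s, of "max \<bar>A\<bar> \<bar>s\<bar>"] by blast
  show ?thesis
  proof (intro exI[of _ r] allI impI)
    fix n e X
    assume e: "e 0 = s" "\<forall>k\<in>{1..n}. m k \<le> e k \<and> \<bar>e k\<bar> \<le> A" and X: "finite X" "X \<subseteq> {0..1}"
      "\<forall>x\<in>X. (\<Sum>k\<le>n. e k * x ^ k) = 0"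
    \<comment> \<open>Admissibility bounds all coefficients, and those beyond \<open>n\<close> do not enter the sum.\<close>
    let ?e = "\<lambda>k. if k \<le> n then e k else 0"
    have "\<bar>?e k\<bar> \<le> max \<bar>A\<bar> \<bar>s\<bar>" for k
    proof (cases "k \<in> {1..n}")
      case True
      then have "\<bar>e k\<bar> \<le> A" using e(2) by blast
      then show ?thesis using True by auto
    next
      case False
      then show ?thesis using e(1) by (cases "k = 0") auto
    qed
    moreover have "c k \<le> e k" if "k \<in> {1..n}" for k using cm[of k] e(2) that by force
    ultimately have "admissible c s (max \<bar>A\<bar> \<bar>s\<bar>) n ?e" using e(1) by (auto simp: admissible_def)
    then show "card X < r" using X by (intro r[of n ?e X]) auto
  qed
qed

theorem mainTheorem2:
  fixes M :: nat and E :: "nat \<Rightarrow> real set"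
  assumes "M \<ge> 1"
    and "\<And>k. k \<ge> 1 \<Longrightarrow> E k \<noteq> {}"
    and "\<And>k. k \<ge> 1 \<Longrightarrow> closed (E k)"
    and "\<exists>A>0. \<forall>k\<ge>1. E k \<subseteq> {-A..A}"
    and "\<And>k. k \<ge> 1 \<Longrightarrow> E (k + M) = E k"
    and "\<And>r::nat. r \<ge> 1 \<Longrightarrow>
      \<exists>n\<ge>1. \<exists>\<epsilon> :: nat \<Rightarrow> real. \<exists>P :: real poly.
        (\<forall>k\<in>{1..n}. \<epsilon> k \<in> E k) \<and>
        P = 1 + (\<Sum>k=1..n. monom (\<epsilon> k) k) \<and>
        card {x \<in> {0..1}. poly P x = 0} \<ge> r"
  shows "(\<Sum>k=1..M. (LEAST x. x \<in> E k)) < 0 \<and>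
         (\<Sum>k=1..M. (GREATEST x. x \<in> E k)) > 0"
proof -
  obtain A where A: "\<And>k. k \<ge> 1 \<Longrightarrow> E k \<subseteq> {-A..A}" using assms(4) by blast
  have least: "(LEAST x. x \<in> E k) \<le> y" and greatest: "y \<le> (GREATEST x. x \<in> E k)"
    if k: "k \<ge> 1" and y: "y \<in> E k" for k y
  proof -
    have "bounded (E k)" using A[OF k] bounded_closed_interval bounded_subset by blast
    then have cpt: "compact (E k)" using assms(3)[OF k] by (simp add: compact_eq_bounded_closed)
    obtain l where l: "l \<in> E k" "\<And>y. y \<in> E k \<Longrightarrow> l \<le> y" using compact_attains_inf[OF cpt assms(2)[OF k]] by blast
    have "(LEAST x. x \<in> E k) = l" using l by (intro Least_equality) auto
    then show "(LEAST x. x \<in> E k) \<le> y" using l y by simp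
    obtain g where g: "g \<in> E k" "\<And>y. y \<in> E k \<Longrightarrow> y \<le> g" using compact_attains_sup[OF cpt assms(2)[OF k]] by blast
    have "(GREATEST x. x \<in> E k) = g" using g by (intro Greatest_equality) auto
    then show "y \<le> (GREATEST x. x \<in> E k)" using g y by simp
  qed
  have many: "\<exists>n e X. e 0 = 1 \<and> (\<forall>k\<in>{1..n}. e k \<in> E k) \<and> finite X \<and> X \<subseteq> {0..1} \<and>
    (\<forall>x\<in>X. (\<Sum>k\<le>n. e k * x ^ k) = 0) \<and> r \<le> card X" for r
  proof -
    obtain n \<epsilon> P where P: "\<forall>k\<in>{1..n}. \<epsilon> k \<in> E k" "P = 1 + (\<Sum>k=1..n. monom (\<epsilon> k) k)"
      "card {x \<in> {0..1}. poly P x = 0} \<ge> Suc r"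
      using assms(6)[of "Suc r"] by auto
    let ?e = "\<epsilon>(0 := 1)"
    have "(\<Sum>k\<le>n. ?e k * x ^ k) = poly P x" for x
      by (simp add: P(2) poly_sum poly_monom atMost_atLeast0 sum.atLeast_Suc_atMost)
    moreover have "finite {x \<in> {0..1}. poly P x = 0}" using P(3) by (intro card_ge_0_finite) auto
    ultimately show ?thesis using P
      by (intro exI[of _ n] exI[of _ ?e] exI[of _ "{x \<in> {0..1}. poly P x = 0}"]) auto
  qed
  have bd: "\<bar>y\<bar> \<le> A" if "k \<ge> 1" "y \<in> E k" for k y using subsetD[OF A[OF that(1)] that(2)] by auto
  show ?thesis
  proof (intro conjI; rule ccontr)
    assume "\<not> (\<Sum>k=1..M. (LEAST x. x \<in> E k)) < 0"
    then have "\<exists>r. \<forall>n e X. e 0 = 1 \<longrightarrow> (\<forall>k\<in>{1..n}. (LEAST x. x \<in> E k) \<le> e k \<and> \<bar>e k\<bar> \<le> A) \<longrightarrow> finite X \<longrightarrow> 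
       X \<subseteq> {0..1} \<longrightarrow> (\<forall>x\<in>X. (\<Sum>k\<le>n. e k * x ^ k) = 0) \<longrightarrow> card X < r"
      using assms(1,5) by (intro roots_bounded_if_lower_sum_nonneg[of M]) auto
    then obtain r where r: "\<And>n e X. e 0 = 1 \<Longrightarrow> (\<forall>k\<in>{1..n}. (LEAST x. x \<in> E k) \<le> e k \<and> \<bar>e k\<bar> \<le> A) \<Longrightarrow> finite X \<Longrightarrow>
       X \<subseteq> {0..1} \<Longrightarrow> (\<forall>x\<in>X. (\<Sum>k\<le>n. e k * x ^ k) = 0) \<Longrightarrow> card X < r" by blast
    obtain n e X where e: "e 0 = 1" "\<forall>k\<in>{1..n}. e k \<in> E k" and X: "finite X" "X \<subseteq> {0..1}"
      "\<forall>x\<in>X. (\<Sum>k\<le>n. e k * x ^ k) = 0" "r \<le> card X" using many by blast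
    have "card X < r" using e least bd X by (intro r[of e n X]) auto
    with X(4) show False by simp
  next
    assume "\<not> (\<Sum>k=1..M. (GREATEST x. x \<in> E k)) > 0"
    then have "\<exists>r. \<forall>n e X. e 0 = - 1 \<longrightarrow> (\<forall>k\<in>{1..n}. - (GREATEST x. x \<in> E k) \<le> e k \<and> \<bar>e k\<bar> \<le> A) \<longrightarrow> finite X \<longrightarrow> 
       X \<subseteq> {0..1} \<longrightarrow> (\<forall>x\<in>X. (\<Sum>k\<le>n. e k * x ^ k) = 0) \<longrightarrow> card X < r"
      using assms(1,5) by (intro roots_bounded_if_lower_sum_nonneg[of M]) (auto simp: sum_negf)
    then obtain r where r: "\<And>n e X. e 0 = - 1 \<Longrightarrow> (\<forall>k\<in>{1..n}. - (GREATEST x. x \<in> E k) \<le> e k \<and> \<bar>e k\<bar> \<le> A) \<Longrightarrow> finite X \<Longrightarrow>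
       X \<subseteq> {0..1} \<Longrightarrow> (\<forall>x\<in>X. (\<Sum>k\<le>n. e k * x ^ k) = 0) \<Longrightarrow> card X < r" by blast
    obtain n e X where e: "e 0 = 1" "\<forall>k\<in>{1..n}. e k \<in> E k" and X: "finite X" "X \<subseteq> {0..1}"
      "\<forall>x\<in>X. (\<Sum>k\<le>n. e k * x ^ k) = 0" "r \<le> card X" using many by blast
    have "card X < r" using e greatest bd X by (intro r[of "\<lambda>k. - e k" n X]) (auto simp: sum_negf)
    with X(4) show False by simp
  qed
qed

end
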